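(* For every integer $k\ge 6$, there exist infinitely many pairwise non-isomorphic $k$-graphs $(X,\mathscr{M})$ such that: 1. $(X,\mathscr{M})$ is asymmetric. 2. If $(X',\mathscr{M}')$ is a proper $k$-subgraph of $(X,\mathscr{M})$ with at least two vertices, then $(X',\mathscr{M}')$ has an involution.
   Context: A $k$-graph (or $k$-uniform hypergraph) is a pair $(X,\mathscr{M})$ where $X$ is a finite set (the vertices) and $\mathscr{M}\subseteq\binom{X}{k}=\{A\subseteq X: |A|=k\}$ (the edges). An automorphism of $(X,\mathscr{M})$ is a bijection $\phi:X\to X$ such that, for every $A\subseteq X$ with $|A|=k$, $A\in\mathscr{M}$ if and only if $\phi(A)\in\mathscr{M}$. A $k$-graph is asymmetric if its only automorphism is the identity. An involution of a $k$-graph is a non-identical automorphism $\phi$ such that $\phi\circ\phi$ is the identity. A $k$-subgraph of $(X,\mathscr{M})$ is a $k$-graph $(X',\mathscr{M}')$ with $X'\subseteq X$ and $\mathscr{M}'\subseteq\mathscr{M}$ (not necessarily induced); it is proper if $(X',\mathscr{M}')\ne(X,\mathscr{M})$. "Infinitely many" is understood up to isomorphism. *)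

theory Defs
  imports Main
begin

text \<open>A hypergraph is a pair (vertices, edges).\<close>

type_synonym 'a hypergraph = "'a set \<times> 'a set set"

definition kgraph :: "nat \<Rightarrow> 'a hypergraph \<Rightarrow> bool" where
  "kgraph k G \<longleftrightarrow> finite (fst G) \<and> snd G \<subseteq> {A. A \<subseteq> fst G \<and> card A = k}"

text \<open>Maps between vertex sets are total functions on the type whose values outside the
  vertex set are irrelevant; accordingly, equality with the identity is only ever required
  (or denied) on the vertex set.\<close>

definition isomorphism :: "nat \<Rightarrow> 'a hypergraph \<Rightarrow> 'b hypergraph \<Rightarrow> ('a \<Rightarrow> 'b) \<Rightarrow> bool" where
  "isomorphism k G H \<phi> \<longleftrightarrow>
     bij_betw \<phi> (fst G) (fst H) \<and>
     (\<forall>A. A \<subseteq> fst G \<and> card A = k \<longrightarrow> (A \<in> snd G \<longleftrightarrow> \<phi> ` A \<in> snd H))"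

definition isomorphic :: "nat \<Rightarrow> 'a hypergraph \<Rightarrow> 'b hypergraph \<Rightarrow> bool" where
  "isomorphic k G H \<longleftrightarrow> (\<exists>\<phi>. isomorphism k G H \<phi>)"

definition automorphism :: "nat \<Rightarrow> 'a hypergraph \<Rightarrow> ('a \<Rightarrow> 'a) \<Rightarrow> bool" where
  "automorphism k G \<phi> \<longleftrightarrow> isomorphism k G G \<phi>"

definition asymmetric :: "nat \<Rightarrow> 'a hypergraph \<Rightarrow> bool" where
  "asymmetric k G \<longleftrightarrow> (\<forall>\<phi>. automorphism k G \<phi> \<longrightarrow> (\<forall>x\<in>fst G. \<phi> x = x))"

definition involution :: "nat \<Rightarrow> 'a hypergraph \<Rightarrow> ('a \<Rightarrow> 'a) \<Rightarrow> bool" where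
  "involution k G \<phi> \<longleftrightarrow>
     automorphism k G \<phi> \<and> (\<exists>x\<in>fst G. \<phi> x \<noteq> x) \<and> (\<forall>x\<in>fst G. \<phi> (\<phi> x) = x)"

definition ksubgraph :: "nat \<Rightarrow> 'a hypergraph \<Rightarrow> 'a hypergraph \<Rightarrow> bool" where
  "ksubgraph k H G \<longleftrightarrow> kgraph k H \<and> fst H \<subseteq> fst G \<and> snd H \<subseteq> snd G"

definition proper_ksubgraph :: "nat \<Rightarrow> 'a hypergraph \<Rightarrow> 'a hypergraph \<Rightarrow> bool" where
  "proper_ksubgraph k H G \<longleftrightarrow> ksubgraph k H G \<and> H \<noteq> G"

end

theory Submission
  imports Defs "HOL-Library.Nat_Bijection" "HOL-Combinatorics.Transposition"
begin

text \<open>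
  The construction is easiest to see in the dual picture. Label each vertex of a hypergraph
  by the set of (indices of) edges that contain it. Call two vertices twins if their labels
  agree. A hypergraph without twins and without isolated vertices amounts to a system \<open>\<T>\<close> of
  nonempty subsets of the index set \<open>I\<close> of its edges; it is \<open>k\<close>-uniform exactly when every
  index lies in \<open>k\<close> members of \<open>\<T>\<close>.

  Suppose that \<open>\<T>\<close> contains all singletons and that its two-element members form a connected
  graph on \<open>I\<close>. If only the edges in a nonempty proper subset \<open>J\<close> of \<open>I\<close> are kept, some pair
  \<open>{i, j}\<close> of \<open>\<T>\<close> leaves \<open>J\<close>, say \<open>i \<in> J\<close> and \<open>j \<notin> J\<close>. After the deletion the vertices
  labelled \<open>{i}\<close> and \<open>{i, j}\<close> both lie in the single edge \<open>i\<close>: they have become twins, and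
  exchanging them is an involution. If no edge is kept, any two vertices can be exchanged. Hence
  every proper subgraph with at least two vertices has an involution
  (\<open>proper_subgraph_has_involution\<close>). On the other hand an automorphism of the hypergraph
  permutes the edges, the induced permutation of \<open>I\<close> preserves \<open>\<T>\<close>, and the automorphism is
  determined by that permutation, since labels are distinct; so the hypergraph is asymmetric as
  soon as \<open>\<T>\<close> is (\<open>asymmetric_if_rigid\<close>).

  What remains is an asymmetric set system on \<open>{..<n}\<close>, regular of degree \<open>k\<close>, with all
  singletons and a connected graph of pairs. Take as pairs the path \<open>0, 1, \<dots>, n - 1\<close>. Its only
  nontrivial symmetry, the reversal, is destroyed by a single three-element set
  \<open>{0, 1, n - 1}\<close>. The degrees are then evened out by large sets: \<open>{0, 2, \<dots>, n - 1}\<close>, which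
  together with the three-element set covers the two ends of the path twice and all other
  indices once, so that all degrees become four; and \<open>k - 4\<close> partitions of \<open>{..<n}\<close> into an
  initial and a final segment, each of which raises all degrees by one. Different \<open>n\<close> give different numbers of edges, hence non-isomorphic
  hypergraphs.
\<close>


section \<open>Twins and involutions\<close>

lemma involution_if_twins:
  assumes "x \<in> fst H" "y \<in> fst H" "x \<noteq> y"
    and twins: "\<And>A. A \<in> snd H \<Longrightarrow> x \<in> A \<longleftrightarrow> y \<in> A"
  shows "involution k H (transpose x y)"
proof -
  let ?t = "transpose x y"
  have fixes_edges: "?t ` A = A" if "x \<in> A \<longleftrightarrow> y \<in> A" for A
    using that by (auto simp: transpose_def image_iff)
  have "bij_betw ?t (fst H) (fst H)"
    using assms(1,2) fixes_edges[of "fst H"] by (simp add: bij_betw_def)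
  moreover have "A \<in> snd H \<longleftrightarrow> ?t ` A \<in> snd H" for A
  proof
    assume "A \<in> snd H"
    then show "?t ` A \<in> snd H" using fixes_edges[OF twins] by simp
  next
    assume "?t ` A \<in> snd H"
    then have "?t ` (?t ` A) = ?t ` A" using fixes_edges[OF twins] by simp
    moreover have "?t ` (?t ` A) = A" by (simp add: image_image)
    ultimately show "A \<in> snd H" using \<open>?t ` A \<in> snd H\<close> by simp
  qed
  moreover have "?t x \<noteq> x" using \<open>x \<noteq> y\<close> by simp
  ultimately show ?thesis
    using assms(1) unfolding involution_def automorphism_def isomorphism_def
    by (intro conjI allI impI ballI bexI[of _ x]) simp_all
qed


section \<open>Hypergraphs as dual set systems\<close>

definition hyperedge :: "'a set \<Rightarrow> ('a \<Rightarrow> 'i set) \<Rightarrow> 'i \<Rightarrow> 'a set" where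
  "hyperedge X T i = {x \<in> X. i \<in> T x}"

definition dual :: "'a set \<Rightarrow> ('a \<Rightarrow> 'i set) \<Rightarrow> 'i set \<Rightarrow> 'a hypergraph" where
  "dual X T I = (X, hyperedge X T ` I)"

locale labelled_vertices =
  fixes X :: "'a set" and T :: "'a \<Rightarrow> 'i set" and I :: "'i set" and k :: nat
  assumes finite_vertices: "finite X"
    and finite_indices: "finite I"
    and labels: "\<And>x. x \<in> X \<Longrightarrow> T x \<noteq> {} \<and> T x \<subseteq> I"
    and distinct_labels: "inj_on T X"
    and degree: "\<And>i. i \<in> I \<Longrightarrow> card (hyperedge X T i) = k"
    and singletons: "\<And>i. i \<in> I \<Longrightarrow> {i} \<in> T ` X"
begin

lemma kgraph_dual: "kgraph k (dual X T I)"
  using finite_vertices degree by (auto simp: kgraph_def dual_def hyperedge_def)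

text \<open>The vertex labelled \<open>{i}\<close> lies in the edge \<open>i\<close> only and so tells it from all others.\<close>

lemma inj_on_hyperedge: "inj_on (hyperedge X T) I"
proof
  fix i j assume "i \<in> I" "j \<in> I" and eq: "hyperedge X T i = hyperedge X T j"
  obtain x where "x \<in> X" "T x = {i}" using singletons[OF \<open>i \<in> I\<close>] by auto
  then have "x \<in> hyperedge X T i" by (simp add: hyperedge_def)
  then have "x \<in> hyperedge X T j" using eq by simp
  then show "i = j" using \<open>T x = {i}\<close> by (simp add: hyperedge_def)
qed

lemma card_edges: "card (snd (dual X T I)) = card I"
  by (simp add: dual_def card_image[OF inj_on_hyperedge])

theorem proper_subgraph_has_involution:
  assumes connected: "\<And>J. J \<subset> I \<Longrightarrow> J \<noteq> {} \<Longrightarrow> \<exists>i\<in>J. \<exists>j\<in>I - J. {i, j} \<in> T ` X"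
    and proper: "proper_ksubgraph k H (dual X T I)" and "card (fst H) \<ge> 2"
  shows "\<exists>\<phi>. involution k H \<phi>"
proof (cases "snd H = {}")
  case True
  then show ?thesis
    using involution_if_twins[of _ H] \<open>card (fst H) \<ge> 2\<close>
    by (metis card_le_Suc0_iff_eq card.infinite empty_iff not_less_eq_eq numeral_2_eq_2 zero_le)
next
  case False
  have sub: "fst H \<subseteq> X" "snd H \<subseteq> hyperedge X T ` I" "H \<noteq> dual X T I"
    and spans: "\<And>A. A \<in> snd H \<Longrightarrow> A \<subseteq> fst H"
    using proper by (auto simp: proper_ksubgraph_def ksubgraph_def kgraph_def dual_def)
  define J where "J = {i \<in> I. hyperedge X T i \<in> snd H}"
  have edges: "snd H = hyperedge X T ` J" using sub(2) by (auto simp: J_def)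
  have "J \<noteq> {}" using False edges by auto
  have "J \<noteq> I"
  proof
    \<comment> \<open>No vertex is isolated, so keeping all edges forces all vertices to be kept.\<close>
    assume "J = I"
    have "X \<subseteq> fst H"
    proof
      fix x assume "x \<in> X"
      then obtain i where "i \<in> T x" "i \<in> I" using labels by blast
      then have "x \<in> hyperedge X T i" "hyperedge X T i \<in> snd H"
        using \<open>x \<in> X\<close> edges \<open>J = I\<close> by (auto simp: hyperedge_def)
      then show "x \<in> fst H" using spans by blast
    qed
    then have "H = dual X T I"
      using sub(1) edges \<open>J = I\<close> by (simp add: dual_def prod_eq_iff)
    then show False using sub(3) by simp
  qed
  moreover have "J \<subseteq> I" by (auto simp: J_def)
  ultimately obtain i j where ij: "i \<in> J" "j \<in> I" "j \<notin> J" "{i, j} \<in> T ` X"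
    using connected[of J] \<open>J \<noteq> {}\<close> by blast
  then obtain y where y: "y \<in> X" "T y = {i, j}" by auto
  obtain x where x: "x \<in> X" "T x = {i}" using singletons[of i] ij(1) \<open>J \<subseteq> I\<close> by auto
  have "hyperedge X T i \<subseteq> fst H" using spans edges ij(1) by blast
  then have "x \<in> fst H" "y \<in> fst H" using x y by (auto simp: hyperedge_def)
  moreover have "x \<noteq> y" using x y ij by auto
  moreover have "x \<in> A \<longleftrightarrow> y \<in> A" if "A \<in> snd H" for A
    using that x y ij(3) by (auto simp: edges hyperedge_def)
  ultimately show ?thesis using involution_if_twins by metis
qed

theorem asymmetric_if_rigid:
  assumes rigid: "\<And>\<sigma>. inj_on \<sigma> I \<Longrightarrow> \<sigma> ` I \<subseteq> I \<Longrightarrow> (\<And>S. S \<in> T ` X \<Longrightarrow> \<sigma> ` S \<in> T ` X)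
                    \<Longrightarrow> \<forall>i\<in>I. \<sigma> i = i"
  shows "asymmetric k (dual X T I)"
  unfolding asymmetric_def
proof (intro allI impI ballI)
  fix \<phi> x
  assume "automorphism k (dual X T I) \<phi>" and "x \<in> fst (dual X T I)"
  then have bij: "bij_betw \<phi> X X" and "x \<in> X"
    and edge: "\<And>A. A \<subseteq> X \<Longrightarrow> card A = k \<Longrightarrow>
      A \<in> hyperedge X T ` I \<longleftrightarrow> \<phi> ` A \<in> hyperedge X T ` I"
    by (auto simp: automorphism_def isomorphism_def dual_def)
  have inj: "inj_on \<phi> X" and onto: "\<phi> ` X = X" using bij by (auto simp: bij_betw_def)
  have in_X: "hyperedge X T i \<subseteq> X" for i by (auto simp: hyperedge_def)
  \<comment> \<open>\<open>\<sigma>\<close> is the permutation of the edges induced by the automorphism.\<close>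
  have "\<forall>i\<in>I. \<exists>j\<in>I. \<phi> ` hyperedge X T i = hyperedge X T j"
    using edge[OF in_X degree] by blast
  then obtain \<sigma> where \<sigma>: "\<And>i. i \<in> I \<Longrightarrow> \<sigma> i \<in> I"
      "\<And>i. i \<in> I \<Longrightarrow> \<phi> ` hyperedge X T i = hyperedge X T (\<sigma> i)"
    by metis
  have inj_\<sigma>: "inj_on \<sigma> I"
  proof
    fix i j assume "i \<in> I" "j \<in> I" "\<sigma> i = \<sigma> j"
    then have "\<phi> ` hyperedge X T i = \<phi> ` hyperedge X T j" using \<sigma>(2) by metis
    then have "hyperedge X T i = hyperedge X T j"
      using inj_on_image_eq_iff[OF inj in_X in_X] by blast
    then show "i = j" using inj_on_hyperedge \<open>i \<in> I\<close> \<open>j \<in> I\<close> by (auto dest: inj_onD)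
  qed
  have "\<sigma> ` I \<subseteq> I" using \<sigma>(1) by auto
  then have surj_\<sigma>: "\<sigma> ` I = I" using inj_\<sigma> finite_indices endo_inj_surj by blast
  have label_image: "T (\<phi> z) = \<sigma> ` T z" if "z \<in> X" for z
  proof -
    have "\<phi> z \<in> X" using that onto by auto
    have iff: "i \<in> T z \<longleftrightarrow> \<sigma> i \<in> T (\<phi> z)" if "i \<in> I" for i
    proof -
      have "i \<in> T z \<longleftrightarrow> z \<in> hyperedge X T i" using \<open>z \<in> X\<close> by (simp add: hyperedge_def)
      also have "\<dots> \<longleftrightarrow> \<phi> z \<in> \<phi> ` hyperedge X T i"
        using inj_on_image_mem_iff[OF inj \<open>z \<in> X\<close> in_X] by blast
      also have "\<dots> \<longleftrightarrow> \<sigma> i \<in> T (\<phi> z)"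
        using \<sigma>(2)[OF that] \<open>\<phi> z \<in> X\<close> by (simp add: hyperedge_def)
      finally show ?thesis .
    qed
    have "T z \<subseteq> I" "T (\<phi> z) \<subseteq> I" using labels that \<open>\<phi> z \<in> X\<close> by auto
    show ?thesis
    proof
      show "T (\<phi> z) \<subseteq> \<sigma> ` T z"
      proof
        fix j assume j: "j \<in> T (\<phi> z)"
        then obtain i where "i \<in> I" "j = \<sigma> i" using \<open>T (\<phi> z) \<subseteq> I\<close> surj_\<sigma> by blast
        then show "j \<in> \<sigma> ` T z" using iff j by simp
      qed
      show "\<sigma> ` T z \<subseteq> T (\<phi> z)" using iff \<open>T z \<subseteq> I\<close> by auto
    qed
  qed
  have "\<sigma> ` S \<in> T ` X" if S: "S \<in> T ` X" for S
  proof -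
    obtain z where "z \<in> X" "S = T z" using S by auto
    then have "\<sigma> ` S = T (\<phi> z)" "\<phi> z \<in> X" using label_image onto by auto
    then show ?thesis by auto
  qed
  then have "\<forall>i\<in>I. \<sigma> i = i" using rigid inj_\<sigma> \<open>\<sigma> ` I \<subseteq> I\<close> by blast
  then have "\<sigma> ` T x = T x" using labels[OF \<open>x \<in> X\<close>] by (auto simp: subset_iff image_iff)
  then have "T (\<phi> x) = T x" using label_image[OF \<open>x \<in> X\<close>] by simp
  moreover have "\<phi> x \<in> X" using onto \<open>x \<in> X\<close> by auto
  ultimately show "\<phi> x = x" using distinct_labels \<open>x \<in> X\<close> by (simp add: inj_on_eq_iff)
qed

end

lemma isomorphic_card_edges:
  assumes "isomorphic k G H" "kgraph k G" "kgraph k H"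
  shows "card (snd G) = card (snd H)"
proof -
  obtain \<phi> where bij: "bij_betw \<phi> (fst G) (fst H)"
    and edge: "\<And>A. A \<subseteq> fst G \<Longrightarrow> card A = k \<Longrightarrow> A \<in> snd G \<longleftrightarrow> \<phi> ` A \<in> snd H"
    using assms(1) by (auto simp: isomorphic_def isomorphism_def)
  have inj: "inj_on \<phi> (fst G)" using bij by (simp add: bij_betw_def)
  have G: "\<And>A. A \<in> snd G \<Longrightarrow> A \<subseteq> fst G \<and> card A = k"
    and H: "\<And>A. A \<in> snd H \<Longrightarrow> A \<subseteq> fst H \<and> card A = k"
    using assms(2,3) by (auto simp: kgraph_def)
  have "inj_on ((`) \<phi>) (snd G)"
    using G inj_on_image_eq_iff[OF inj] by (meson inj_onI)
  moreover have "(`) \<phi> ` snd G = snd H"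
  proof
    show "(`) \<phi> ` snd G \<subseteq> snd H" using G edge by auto
  next
    show "snd H \<subseteq> (`) \<phi> ` snd G"
    proof
      fix B assume B: "B \<in> snd H"
      then have "B \<subseteq> \<phi> ` fst G" using H bij by (auto simp: bij_betw_def)
      then obtain A where A: "A \<subseteq> fst G" "B = \<phi> ` A" by (auto simp: subset_image_iff)
      then have "card A = k" using H[OF B] card_image[OF inj_on_subset[OF inj A(1)]] by simp
      then have "A \<in> snd G" using edge A B by simp
      then show "B \<in> (`) \<phi> ` snd G" using A by simp
    qed
  qed
  ultimately show ?thesis by (metis card_image)
qed


section \<open>An asymmetric regular set system\<close>

definition path_system :: "nat \<Rightarrow> nat \<Rightarrow> nat set set" where
  "path_system k n =
     (\<lambda>i. {i}) ` {..<n} \<union> {{i, Suc i} | i. Suc i < n} \<union>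
     {{0, 1, n - 1}, insert 0 {2..<n}} \<union>
     (\<lambda>m. {..<m}) ` {4..<k} \<union> (\<lambda>m. {m..<n}) ` {4..<k}"

context
  fixes k n :: nat
  assumes k: "k \<ge> 4" and n: "n \<ge> k + 3"
begin

lemma path_system_members:
  assumes "S \<in> path_system k n"
  shows "S \<noteq> {}" "S \<subseteq> {..<n}"
proof -
  have "0 \<in> {..<m}" if "m \<in> {4..<k}" for m
    using that by simp
  moreover have "n - 1 \<in> {m..<n}" if "m \<in> {4..<k}" for m
    using that n by auto
  ultimately show "S \<noteq> {}" using assms unfolding path_system_def by blast
  show "S \<subseteq> {..<n}" using assms k n by (auto simp: path_system_def)
qed

lemma singleton_in_path_system: "i < n \<Longrightarrow> {i} \<in> path_system k n"
  by (auto simp: path_system_def)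

lemma pair_in_path_system: "Suc i < n \<Longrightarrow> {i, Suc i} \<in> path_system k n"
  by (auto simp: path_system_def)

text \<open>The bound on \<open>n\<close> gives every segment and the near-complete set at least four elements, so
  that cardinality alone recognises the path and the three-element set.\<close>

lemma path_system_by_card:
  assumes "S \<in> path_system k n"
  shows "card S = 2 \<Longrightarrow> \<exists>i. S = {i, Suc i} \<and> Suc i < n"
    and "card S = 3 \<Longrightarrow> S = {0, 1, n - 1}"
proof -
  consider i where "S = {i}" | i where "S = {i, Suc i}" "Suc i < n" | "S = {0, 1, n - 1}"
    | "S = insert 0 {2..<n}" | m where "S = {..<m}" "4 \<le> m" | m where "S = {m..<n}" "m < k"
    using assms by (auto simp: path_system_def)
  then have "card S = 1 \<or> (\<exists>i. card S = 2 \<and> S = {i, Suc i} \<and> Suc i < n)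
      \<or> card S = 3 \<and> S = {0, 1, n - 1} \<or> card S \<ge> 4"
    using k n by cases auto
  then show "card S = 2 \<Longrightarrow> \<exists>i. S = {i, Suc i} \<and> Suc i < n"
    and "card S = 3 \<Longrightarrow> S = {0, 1, n - 1}" by auto
qed

lemma path_system_degree:
  assumes "i < n"
  shows "card {S \<in> path_system k n. i \<in> S} = k"
proof -
  define long where "long m = (if i < m then {..<m} else {m..<n})" for m
  define short where
    "short = (if i = 0 then {{0}, {0, 1}, {0, 1, n - 1}, insert 0 {2..<n}}
       else if i = n - 1 then {{i}, {i - 1, i}, {0, 1, n - 1}, insert 0 {2..<n}}
       else {{i}, {i - 1, i}, {i, Suc i},
             if i = 1 then {0, 1, n - 1} else insert 0 {2..<n}})"
  have pairs: "{S \<in> {{j, Suc j} | j. Suc j < n}. i \<in> S} =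
      (if i = 0 then {{0, 1}} else if i = n - 1 then {{i - 1, i}} else {{i - 1, i}, {i, Suc i}})"
    (is "?L = ?R")
  proof
    show "?L \<subseteq> ?R" using n by auto
    have "{i - 1, i} \<in> ?L" if "i \<noteq> 0"
      using that assms by (auto intro!: exI[of _ "i - 1"])
    moreover have "{i, Suc i} \<in> ?L" if "i \<noteq> n - 1"
      using that assms by auto
    ultimately show "?R \<subseteq> ?L" using n assms by auto
  qed
  have segments: "{S \<in> (\<lambda>m. {..<m}) ` {4..<k} \<union> (\<lambda>m. {m..<n}) ` {4..<k}. i \<in> S}
      = long ` {4..<k}"
    using assms by (auto simp: long_def image_iff)
  have loops: "{S \<in> (\<lambda>i. {i}) ` {..<n}. i \<in> S} = {{i}}" using assms by auto
  have special: "{S \<in> {{0, 1, n - 1}, insert 0 {2..<n}}. i \<in> S} =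
      (if i = 0 \<or> i = n - 1 then {{0, 1, n - 1}, insert 0 {2..<n}}
       else if i = 1 then {{0, 1, n - 1}} else {insert 0 {2..<n}})"
    using assms n k by auto
  have "{S \<in> path_system k n. i \<in> S} =
      {S \<in> (\<lambda>i. {i}) ` {..<n}. i \<in> S} \<union> {S \<in> {{j, Suc j} | j. Suc j < n}. i \<in> S} \<union>
      {S \<in> {{0, 1, n - 1}, insert 0 {2..<n}}. i \<in> S} \<union>
      {S \<in> (\<lambda>m. {..<m}) ` {4..<k} \<union> (\<lambda>m. {m..<n}) ` {4..<k}. i \<in> S}"
    unfolding path_system_def by blast
  also have "\<dots> = short \<union> long ` {4..<k}"
    unfolding loops pairs special segments short_def using n k by auto
  finally have split: "{S \<in> path_system k n. i \<in> S} = short \<union> long ` {4..<k}" .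
  have card_three: "card {0, 1, n - 1} = 3" using n k by simp
  have card_large: "card (insert 0 {2..<n}) = n - 1" using n k by simp
  have card_long: "card (long m) \<ge> 4" if "m \<in> {4..<k}" for m
    using that n by (auto simp: long_def)
  \<comment> \<open>Initial segments contain \<open>0\<close> and \<open>1\<close>, final segments neither.\<close>
  have zero_one: "0 \<in> long m \<longleftrightarrow> 1 \<in> long m" if "m \<in> {4..<k}" for m
    using that n by (auto simp: long_def)
  have "insert 0 {2..<n} \<notin> long ` {4..<k}"
    using zero_one by force
  moreover have "S \<notin> long ` {4..<k}" if "card S \<le> 3" for S
    using card_long that by force
  ultimately have disjoint: "short \<inter> long ` {4..<k} = {}"
    using card_three by (auto simp: short_def card_insert_if split: if_splits)
  have "inj_on long {4..<k}"
  proof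
    fix m m' assume m: "m \<in> {4..<k}" "m' \<in> {4..<k}" and eq: "long m = long m'"
    have "0 \<in> long m \<longleftrightarrow> 0 \<in> long m'" using eq by simp
    then have "i < m \<longleftrightarrow> i < m'" using m n by (auto simp: long_def split: if_splits)
    moreover have "card (long m) = card (long m')" using eq by simp
    ultimately show "m = m'" using m n by (auto simp: long_def split: if_splits)
  qed
  then have card_segments: "card (long ` {4..<k}) = k - 4" by (simp add: card_image)
  have "{0, 1, n - 1} \<noteq> insert 0 {2..<n}" using card_three card_large n k by force
  moreover have "{a} \<noteq> {0, 1, n - 1}" "{a, b} \<noteq> {0, 1, n - 1}"
    "{a} \<noteq> insert 0 {2..<n}" "{a, b} \<noteq> insert 0 {2..<n}" for a b
  proof -
    have le: "card {a} \<le> 2" "card {a, b} \<le> 2" by (auto simp: card_insert_if)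
    show "{a} \<noteq> {0, 1, n - 1}" "{a, b} \<noteq> {0, 1, n - 1}"
      using le card_three by (metis Suc_n_not_le_n numeral_2_eq_2 numeral_3_eq_3)+
    show "{a} \<noteq> insert 0 {2..<n}" "{a, b} \<noteq> insert 0 {2..<n}"
      using le card_large n k by fastforce+
  qed
  ultimately have "card short = 4"
    using assms n k by (auto simp: short_def card_insert_if doubleton_eq_iff)
  moreover have "finite short" by (simp add: short_def)
  ultimately show ?thesis
    unfolding split using card_segments disjoint k by (subst card_Un_disjoint) auto
qed

lemma path_system_connected:
  assumes "J \<subset> {..<n}" "J \<noteq> {}"
  shows "\<exists>i\<in>J. \<exists>j\<in>{..<n} - J. {i, j} \<in> path_system k n"
proof (rule ccontr)
  assume neg: "\<not> ?thesis"
  have step: "i \<in> J \<longleftrightarrow> Suc i \<in> J" if "Suc i < n" for i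
  proof -
    have "{i, Suc i} \<in> path_system k n" "{Suc i, i} \<in> path_system k n"
      using pair_in_path_system[OF that] by (simp_all add: insert_commute)
    then show ?thesis using neg that by (metis DiffI Suc_lessD lessThan_iff)
  qed
  have "i < n \<Longrightarrow> i \<in> J \<longleftrightarrow> 0 \<in> J" for i
    by (induction i) (auto simp: step[symmetric])
  then show False using assms by blast
qed

text \<open>Permutations preserve cardinality, so \<open>\<sigma>\<close> preserves the path and the set
  \<open>{0, 1, n - 1}\<close>. The pair \<open>{0, 1}\<close> is the only link of the path inside this set, hence it is
  mapped to itself. It cannot be flipped, because \<open>0\<close> has no neighbour besides \<open>1\<close> while \<open>1\<close>
  has. Then all of the path is fixed, one index after the other.\<close>

lemma path_system_rigid:
  assumes inj: "inj_on \<sigma> {..<n}"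
    and preserves: "\<And>S. S \<in> path_system k n \<Longrightarrow> \<sigma> ` S \<in> path_system k n"
  shows "\<forall>i\<in>{..<n}. \<sigma> i = i"
proof -
  have distinct: "\<sigma> i = \<sigma> j \<longleftrightarrow> i = j" if "i < n" "j < n" for i j
    using inj that by (auto dest: inj_onD)
  have adjacent: "\<sigma> (Suc i) = Suc (\<sigma> i) \<or> \<sigma> i = Suc (\<sigma> (Suc i))" if "Suc i < n" for i
  proof -
    have "{\<sigma> i, \<sigma> (Suc i)} \<in> path_system k n"
      using preserves[OF pair_in_path_system[OF that]] by simp
    moreover have "card {\<sigma> i, \<sigma> (Suc i)} = 2" using distinct[of i "Suc i"] that by simp
    ultimately show ?thesis using path_system_by_card(1) by (fastforce simp: doubleton_eq_iff)
  qed
  have "{0, 1, n - 1} \<in> path_system k n" by (simp add: path_system_def)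
  then have "\<sigma> ` {0, 1, n - 1} \<in> path_system k n" by (rule preserves)
  moreover have "card (\<sigma> ` {0, 1, n - 1}) = 3"
    using n k by (subst card_image[OF inj_on_subset[OF inj]]) auto
  ultimately have "\<sigma> ` {0, 1, n - 1} = {0, 1, n - 1}" by (rule path_system_by_card(2))
  then have "\<sigma> 0 \<in> {0, 1, n - 1}" "\<sigma> 1 \<in> {0, 1, n - 1}" by blast+
  then have "\<sigma> 0 = 0 \<and> \<sigma> 1 = 1 \<or> \<sigma> 0 = 1 \<and> \<sigma> 1 = 0"
    using adjacent[of 0] n k by auto
  moreover have "\<not> (\<sigma> 0 = 1 \<and> \<sigma> 1 = 0)"
    using adjacent[of 1] distinct[of 0 2] n k by (auto simp: numeral_2_eq_2)
  ultimately have start: "\<sigma> 0 = 0" "\<sigma> 1 = 1" by auto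
  have "Suc i < n \<Longrightarrow> \<sigma> i = i \<and> \<sigma> (Suc i) = Suc i" for i
  proof (induction i)
    case 0
    then show ?case using start by simp
  next
    case (Suc i)
    then have "\<sigma> i = i" "\<sigma> (Suc i) = Suc i" by auto
    then show ?case using adjacent[of "Suc i"] distinct[of i "Suc (Suc i)"] Suc.prems by auto
  qed
  then have "\<sigma> i = i" if "i < n" for i
    using that start by (cases i) auto
  then show ?thesis by auto
qed


section \<open>The infinite family\<close>

text \<open>The vertices have to be natural numbers, so each member of the set system is represented
  by its binary code.\<close>

definition path_hypergraph :: "nat hypergraph" where
  "path_hypergraph = dual (set_encode ` path_system k n) set_decode {..<n}"

lemma decode_path_system: "set_decode ` set_encode ` path_system k n = path_system k n"
proof -
  have "set_decode (set_encode S) = S" if "S \<in> path_system k n" for S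
    using path_system_members(2)[OF that] finite_subset by (intro set_encode_inverse) auto
  then show ?thesis by (simp add: image_image)
qed

lemma labelled_path_system:
  "labelled_vertices (set_encode ` path_system k n) set_decode {..<n} k"
proof
  have "path_system k n \<subseteq> Pow {..<n}" using path_system_members by auto
  then have "finite (path_system k n)" by (rule finite_subset) simp
  then show "finite (set_encode ` path_system k n)" by simp
  show "set_decode x \<noteq> {} \<and> set_decode x \<subseteq> {..<n}"
    if "x \<in> set_encode ` path_system k n" for x
    using path_system_members[of "set_decode x"] that decode_path_system by blast
  show inj: "inj_on set_decode (set_encode ` path_system k n)"
    by (metis inj_onI set_decode_inverse)
  show "{i} \<in> set_decode ` set_encode ` path_system k n" if "i \<in> {..<n}" for i
    using that singleton_in_path_system by (simp add: decode_path_system)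
  show "card (hyperedge (set_encode ` path_system k n) set_decode i) = k"
    if "i \<in> {..<n}" for i
  proof -
    have "set_decode ` hyperedge (set_encode ` path_system k n) set_decode i
        = {S \<in> set_decode ` set_encode ` path_system k n. i \<in> S}"
      by (auto simp: hyperedge_def)
    moreover have "inj_on set_decode (hyperedge (set_encode ` path_system k n) set_decode i)"
      by (rule inj_on_subset[OF inj]) (auto simp: hyperedge_def)
    ultimately show ?thesis
      using path_system_degree that by (metis card_image decode_path_system lessThan_iff)
  qed
qed simp

lemma path_hypergraph_properties:
  shows "kgraph k path_hypergraph" "card (snd path_hypergraph) = n"
    "asymmetric k path_hypergraph"
    "proper_ksubgraph k H path_hypergraph \<Longrightarrow> card (fst H) \<ge> 2 \<Longrightarrow> \<exists>\<phi>. involution k H \<phi>"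
proof -
  interpret labelled_vertices "set_encode ` path_system k n" set_decode "{..<n}" k
    by (rule labelled_path_system)
  show "kgraph k path_hypergraph" "card (snd path_hypergraph) = n"
    using kgraph_dual card_edges by (simp_all add: path_hypergraph_def)
  show "asymmetric k path_hypergraph"
    unfolding path_hypergraph_def
  proof (rule asymmetric_if_rigid)
    fix \<sigma> :: "nat \<Rightarrow> nat"
    assume "inj_on \<sigma> {..<n}" and "\<And>S. S \<in> set_decode ` set_encode ` path_system k n
      \<Longrightarrow> \<sigma> ` S \<in> set_decode ` set_encode ` path_system k n"
    then show "\<forall>i\<in>{..<n}. \<sigma> i = i"
      unfolding decode_path_system by (rule path_system_rigid)
  qed
  show "\<exists>\<phi>. involution k H \<phi>"
    if "proper_ksubgraph k H path_hypergraph" "card (fst H) \<ge> 2"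
  proof (rule proper_subgraph_has_involution)
    show "\<exists>i\<in>J. \<exists>j\<in>{..<n} - J. {i, j} \<in> set_decode ` set_encode ` path_system k n"
      if "J \<subset> {..<n}" "J \<noteq> {}" for J
      unfolding decode_path_system using that by (rule path_system_connected)
  qed (use that in \<open>simp_all add: path_hypergraph_def\<close>)
qed

end

theorem theorem5:
  fixes k :: nat
  assumes "k \<ge> 6"
  shows "\<exists>\<F> :: nat hypergraph set.
           infinite \<F> \<and>
           pairwise (\<lambda>G H. \<not> isomorphic k G H) \<F> \<and>
           (\<forall>G\<in>\<F>. kgraph k G \<and>
                    asymmetric k G \<and>
                    (\<forall>H. proper_ksubgraph k H G \<and> card (fst H) \<ge> 2
                           \<longrightarrow> (\<exists>\<phi>. involution k H \<phi>)))"
proof -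
  have "k \<ge> 4" using assms by simp
  note props = path_hypergraph_properties[OF this]
  let ?\<F> = "path_hypergraph k ` {k + 3..}"
  have "inj_on (path_hypergraph k) {k + 3..}"
    by (rule inj_onI) (metis props(2) atLeast_iff)
  then have "infinite ?\<F>" using infinite_Ici finite_imageD by blast
  moreover have "pairwise (\<lambda>G H. \<not> isomorphic k G H) ?\<F>"
  proof (rule pairwiseI)
    fix G H assume "G \<in> ?\<F>" "H \<in> ?\<F>" "G \<noteq> H"
    then obtain m n where "m \<ge> k + 3" "n \<ge> k + 3" "m \<noteq> n"
        "G = path_hypergraph k m" "H = path_hypergraph k n" by auto
    then show "\<not> isomorphic k G H" using isomorphic_card_edges props(1,2) by metis
  qed
  moreover have "\<forall>G\<in>?\<F>. kgraph k G \<and> asymmetric k G \<and>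
      (\<forall>H. proper_ksubgraph k H G \<and> card (fst H) \<ge> 2 \<longrightarrow> (\<exists>\<phi>. involution k H \<phi>))"
    using props(1,3,4) by auto
  ultimately show ?thesis by blast
qed

end
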